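(* There exist $\delta$ with $0<\delta<1/16$ and $\epsilon_0>0$ such that for every $0<\epsilon<\epsilon_0$ and every integer $N\ge 1$ the following holds. Let $T=\delta\epsilon^{-1}$. Let $(\theta_j,\rho_j)_{1\le j\le N}$ be the solution of $$\dot\theta_j=-(\rho_j-\rho_{j-1})-2(\rho_j-\rho_{j-1})\cos(2\theta_j)+2\rho_{j+1}\cos(2\theta_{j+1})-2\rho_{j-2}\cos(2\theta_{j-1}),$$ $$\dot\rho_j=4\rho_j\rho_{j-1}\sin(2\theta_j)-4\rho_j\rho_{j+1}\sin(2\theta_{j+1}),\qquad j=1,\dots,N,$$ and let $(\tilde\theta_j,\tilde\rho_j)_{1\le j\le N}$ be the solution of $$\dot{\tilde\theta}_j=-(\tilde\rho_j-\tilde\rho_{j-1}),\qquad \dot{\tilde\rho}_j=-4\tilde\rho_j(\tilde\rho_{j+1}-\tilde\rho_{j-1}),\qquad j=1,\dots,N,$$ both with the same initial data $$\theta_j(0)=\tilde\theta_j(0)=\frac{\pi}{4},\qquad \rho_j(0)=\tilde\rho_j(0)=\frac{\epsilon}{8},\qquad j=1,\dots,N.$$ Then $$\sup_{0\le t\le T}\ \max_{1\le j\le N}|\theta_j(t)-\tilde\theta_j(t)|\le\frac{\delta}{8},\qquad \sup_{0\le t\le T}\ \max_{1\le j\le N}|\rho_j(t)-\tilde\rho_j(t)|\le\frac{\delta\epsilon}{32}.$$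
   Context: Convention: the lattice has $N$ nodes $j=1,\dots,N$, and all quantities with index outside $\{1,\dots,N\}$ appearing in the equations are set to $0$; that is, $\rho_j=\tilde\rho_j=0$ and $\theta_j=0$ for $j\le 0$ and $j\ge N+1$. (The values of $\theta_0$ and $\theta_{N+1}$ are immaterial, since they only occur multiplied by a vanishing $\rho$.) Background: the first system is the hydrodynamic form, with $b_j=\sqrt{\rho_j}e^{i\phi_j}$ and $\theta_j=\phi_j-\phi_{j-1}$, of the "Toy Model" $-i\partial_t b_j=-|b_j|^2b_j+2b_{j-1}^2\overline{b_j}+2b_{j+1}^2\overline{b_j}$, $b_0=b_{N+1}=0$. *)

theory Defs
  imports Complex_Main
begin

text \<open>
  A lattice quantity is a function \<open>x :: int \<Rightarrow> real \<Rightarrow> real\<close>, \<open>x j t\<close> being its value at node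
  \<open>j\<close> and time \<open>t\<close>.  The nodes are \<open>j = 1, \<dots>, N\<close>; indices are integers so that \<open>j - 1\<close> and
  \<open>j - 2\<close> are never truncated.  Solutions are considered on the closed time interval \<open>[0, T]\<close>,
  with one-sided derivatives at its end points.
\<close>

definition zero_off_lattice :: "nat \<Rightarrow> real \<Rightarrow> (int \<Rightarrow> real \<Rightarrow> real) \<Rightarrow> bool" where
  "zero_off_lattice N T x \<longleftrightarrow> (\<forall>j. j \<notin> {1..int N} \<longrightarrow> (\<forall>t\<in>{0..T}. x j t = 0))"

text \<open>
  The hydrodynamic form of the Toy Model
  \<open>-i \<partial>\<^sub>t b\<^sub>j = -|b\<^sub>j|\<^sup>2 b\<^sub>j + 2 b\<^bsub>j-1\<^esub>\<^sup>2 cnj b\<^sub>j + 2 b\<^bsub>j+1\<^esub>\<^sup>2 cnj b\<^sub>j\<close>, \<open>b\<^sub>0 = b\<^bsub>N+1\<^esub> = 0\<close>, in the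
  variables given by \<open>b\<^sub>j = sqrt \<rho>\<^sub>j e\<^bsup>i \<phi>\<^esup>\<close> (with \<open>\<phi> = \<phi>\<^sub>j\<close>) and \<open>\<theta>\<^sub>j = \<phi>\<^sub>j - \<phi>\<^bsub>j-1\<^esub>\<close>.
\<close>

definition toy_hydro_solution ::
    "nat \<Rightarrow> real \<Rightarrow> (int \<Rightarrow> real \<Rightarrow> real) \<Rightarrow> (int \<Rightarrow> real \<Rightarrow> real) \<Rightarrow> bool" where
  "toy_hydro_solution N T \<theta> \<rho> \<longleftrightarrow>
     zero_off_lattice N T \<theta> \<and> zero_off_lattice N T \<rho> \<and>
     (\<forall>j\<in>{1..int N}. \<forall>t\<in>{0..T}.
        (\<theta> j has_real_derivative
           (- (\<rho> j t - \<rho> (j - 1) t)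
            - 2 * (\<rho> j t - \<rho> (j - 1) t) * cos (2 * \<theta> j t)
            + 2 * \<rho> (j + 1) t * cos (2 * \<theta> (j + 1) t)
            - 2 * \<rho> (j - 2) t * cos (2 * \<theta> (j - 1) t))) (at t within {0..T}) \<and>
        (\<rho> j has_real_derivative
           (4 * \<rho> j t * \<rho> (j - 1) t * sin (2 * \<theta> j t)
            - 4 * \<rho> j t * \<rho> (j + 1) t * sin (2 * \<theta> (j + 1) t))) (at t within {0..T}))"

definition reduced_hydro_solution ::
    "nat \<Rightarrow> real \<Rightarrow> (int \<Rightarrow> real \<Rightarrow> real) \<Rightarrow> (int \<Rightarrow> real \<Rightarrow> real) \<Rightarrow> bool" where
  "reduced_hydro_solution N T \<theta> \<rho> \<longleftrightarrow>
     zero_off_lattice N T \<theta> \<and> zero_off_lattice N T \<rho> \<and>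
     (\<forall>j\<in>{1..int N}. \<forall>t\<in>{0..T}.
        (\<theta> j has_real_derivative (- (\<rho> j t - \<rho> (j - 1) t))) (at t within {0..T}) \<and>
        (\<rho> j has_real_derivative (- 4 * \<rho> j t * (\<rho> (j + 1) t - \<rho> (j - 1) t)))
          (at t within {0..T}))"

end

theory Submission imports Defs "HOL-Analysis.Derivative" begin

text \<open>
  On the time scale \<open>T = \<delta> / \<epsilon>\<close> the densities, which are of size \<open>\<epsilon>\<close> and evolve quadratically, can
  change only by \<open>O(\<delta> \<epsilon>)\<close>, and the phases, whose velocities are linear in the densities, only by
  \<open>O(\<delta>)\<close>.  At the common initial phase \<open>\<pi>/4\<close> one has \<open>sin (2 \<theta>) = 1\<close> and \<open>cos (2 \<theta>) = 0\<close>, so that the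
  two right-hand sides coincide there as functions of the densities.  Along the solutions their
  difference is therefore smaller than they are by a factor \<open>O(\<delta>)\<close>, and integrating it over \<open>[0, T]\<close>
  gives \<open>|\<rho> - \<rho>'| = O(\<delta>\<^sup>2 \<epsilon>)\<close> and \<open>|\<theta> - \<theta>'| = O(\<delta>\<^sup>2)\<close>.  For small \<open>\<delta>\<close> these are below the required
  \<open>\<delta> \<epsilon> / 32\<close> and \<open>\<delta> / 8\<close>.  Since the time is this short, the plain mean value theorem replaces any
  Gronwall argument, and since every node interacts with boundedly many neighbours, all constants
  are independent of \<open>N\<close>.  Writing \<open>\<rho> = \<epsilon> r\<close> and measuring time in units of \<open>1/\<epsilon>\<close>
  removes \<open>\<epsilon>\<close> from both systems, which is why \<open>\<delta>\<close> can be chosen independently of \<open>\<epsilon>\<close>.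

  The quadratic growth makes the first step a continuity argument (\<open>bootstrap_bound\<close>): as long as
  \<open>|\<rho>| \<le> \<epsilon>/4\<close> the density moves by at most \<open>\<delta> \<epsilon> / 2 < \<epsilon>/8\<close>, so it never reaches that bound.  The
  explicit constants are then collected in \<open>hydro_comparison\<close>, valid for \<open>\<delta> \<le> 1/208\<close>.
\<close>

section \<open>A priori bounds from a velocity bound\<close>

lemma mean_value_bound:
  fixes x :: "real \<Rightarrow> real"
  assumes deriv: "\<And>s. s \<in> {0..T} \<Longrightarrow> (x has_real_derivative x' s) (at s within {0..T})"
    and bound: "\<And>s. 0 < s \<Longrightarrow> s < t \<Longrightarrow> \<bar>x' s\<bar> \<le> B"
    and t: "t \<in> {0..T}"
  shows "\<bar>x t - x 0\<bar> \<le> B * t"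
proof (cases "t = 0")
  case False
  with t have "0 < t" by simp
  moreover have "(x has_derivative (\<lambda>h. h * x' s)) (at s within {0..t})" if "0 \<le> s" "s \<le> t" for s
  proof -
    from that t have "(x has_real_derivative x' s) (at s within {0..t})"
      by (intro has_field_derivative_subset[OF deriv]) auto
    then show ?thesis by (simp add: has_field_derivative_def mult_commute_abs)
  qed
  ultimately obtain s where s: "s \<in> {0<..<t}" "x t - x 0 = (t - 0) * x' s"
    using mvt_simple[of 0 t x "\<lambda>s h. h * x' s"] by auto
  then have "\<bar>x t - x 0\<bar> = t * \<bar>x' s\<bar>" by (simp add: abs_mult)
  also have "\<dots> \<le> t * B" using s bound by (intro mult_left_mono) auto
  finally show ?thesis by (simp add: mult.commute)
qed simp

text \<open>
  The velocity is only controlled while all components are still at most \<open>M\<close>.  At the first time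
  \<open>s\<^sub>0\<close> when some component reaches \<open>M\<close>, the control has held on all of \<open>[0, s\<^sub>0)\<close>, so that component
  is still within \<open>B * T\<close> of its initial value and hence strictly below \<open>M\<close>.  Finiteness of \<open>J\<close> makes
  the set of exit times closed, so that a first one exists.
\<close>

lemma bootstrap_bound:
  fixes x x' :: "'i \<Rightarrow> real \<Rightarrow> real"
  assumes fin: "finite J"
    and deriv: "\<And>j s. j \<in> J \<Longrightarrow> s \<in> {0..T} \<Longrightarrow>
                  (x j has_real_derivative x' j s) (at s within {0..T})"
    and init: "\<And>j. j \<in> J \<Longrightarrow> x j 0 = a"
    and speed: "\<And>j s. j \<in> J \<Longrightarrow> s \<in> {0..T} \<Longrightarrow> (\<And>i. i \<in> J \<Longrightarrow> \<bar>x i s\<bar> \<le> M) \<Longrightarrow> \<bar>x' j s\<bar> \<le> B"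
    and B: "0 \<le> B" and room: "\<bar>a\<bar> + B * T < M"
    and j: "j \<in> J" and t: "t \<in> {0..T}"
  shows "\<bar>x j t\<bar> \<le> M" and "\<bar>x j t - a\<bar> \<le> B * T"
proof -
  have step: "\<bar>x i s - a\<bar> \<le> B * T"
    if "i \<in> J" "s \<in> {0..T}" "\<And>k r. k \<in> J \<Longrightarrow> 0 \<le> r \<Longrightarrow> r < s \<Longrightarrow> \<bar>x k r\<bar> \<le> M" for i s
  proof -
    have "\<bar>x i s - x i 0\<bar> \<le> B * s"
      using deriv[OF that(1)] by (rule mean_value_bound) (use that speed in auto)
    also have "\<dots> \<le> B * T" using that B by (intro mult_left_mono) auto
    finally show ?thesis using init that by simp
  qed
  define S where "S = (\<Union>i\<in>J. {s \<in> {0..T}. M \<le> \<bar>x i s\<bar>})"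
  have below: "\<bar>x i s\<bar> < M" if "i \<in> J" "s \<in> {0..T}" for i s
  proof (rule ccontr)
    assume "\<not> \<bar>x i s\<bar> < M"
    with that have "s \<in> S" unfolding S_def by (intro UN_I[of i]) auto
    then have "S \<noteq> {}" by blast
    moreover have "compact S"
    proof -
      have "closed {s \<in> {0..T}. M \<le> \<bar>x i s\<bar>}" if "i \<in> J" for i
      proof -
        have "continuous_on {0..T} (x i)"
          using deriv[OF that] by (intro DERIV_continuous_on) auto
        then show ?thesis
          by (intro continuous_on_closed_Collect_le continuous_intros) auto
      qed
      with fin have "closed S" unfolding S_def by (intro closed_UN) auto
      then have "compact ({0..T} \<inter> S)" by (intro compact_Int_closed) auto
      moreover have "{0..T} \<inter> S = S" by (auto simp: S_def)
      ultimately show ?thesis by simp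
    qed
    ultimately obtain s\<^sub>0 where s\<^sub>0: "s\<^sub>0 \<in> S" and first: "\<And>s. s \<in> S \<Longrightarrow> s\<^sub>0 \<le> s"
      using compact_attains_inf[of S] by auto
    from s\<^sub>0 obtain k where k: "k \<in> J" "s\<^sub>0 \<in> {0..T}" "M \<le> \<bar>x k s\<^sub>0\<bar>" by (auto simp: S_def)
    have "\<bar>x k s\<^sub>0 - a\<bar> \<le> B * T"
    proof (rule step[OF k(1,2)])
      fix l r assume lr: "l \<in> J" "0 \<le> r" "r < s\<^sub>0"
      show "\<bar>x l r\<bar> \<le> M"
      proof (rule ccontr)
        assume "\<not> \<bar>x l r\<bar> \<le> M"
        with lr k have "r \<in> S" unfolding S_def by (intro UN_I[of l]) auto
        with first lr show False by force
      qed
    qed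
    with room k show False by linarith
  qed
  from below[OF j t] show "\<bar>x j t\<bar> \<le> M" by simp
  show "\<bar>x j t - a\<bar> \<le> B * T"
    using below t by (intro step[OF j t]) (auto intro: less_imp_le)
qed

section \<open>Elementary estimates\<close>

lemma sin_cos_double_near_quarter_pi:
  fixes x :: real
  shows "\<bar>cos (2 * x)\<bar> \<le> 2 * \<bar>x - pi / 4\<bar>" and "\<bar>sin (2 * x) - 1\<bar> \<le> 2 * \<bar>x - pi / 4\<bar>"
proof -
  define y where "y = x - pi / 4"
  have x: "2 * x = pi / 2 + 2 * y" by (simp add: y_def field_simps)
  have c: "cos (2 * x) = - sin (2 * y)" unfolding x by (simp add: cos_add)
  have s: "sin (2 * x) = cos (2 * y)" unfolding x by (simp add: sin_add)
  show "\<bar>cos (2 * x)\<bar> \<le> 2 * \<bar>x - pi / 4\<bar>"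
    using abs_sin_x_le_abs_x[of "2 * y"] unfolding c y_def[symmetric] by (simp add: abs_mult)
  have "\<bar>sin (2 * x) - 1\<bar> = 2 * (\<bar>sin y\<bar> * \<bar>sin y\<bar>)"
    unfolding s by (simp add: cos_double_sin power2_eq_square)
  also have "\<dots> \<le> 2 * (\<bar>y\<bar> * 1)"
    using abs_sin_x_le_abs_x[of y] by (intro mult_left_mono mult_mono) auto
  finally show "\<bar>sin (2 * x) - 1\<bar> \<le> 2 * \<bar>x - pi / 4\<bar>" by (simp add: y_def)
qed

lemma abs_mult_le:
  fixes a b :: real
  assumes "\<bar>a\<bar> \<le> A" "\<bar>b\<bar> \<le> B"
  shows "\<bar>a * b\<bar> \<le> A * B"
  unfolding abs_mult using assms by (intro mult_mono) auto

lemma abs_mult_diff_le: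
  fixes a b a' b' :: real
  assumes "\<bar>a\<bar> \<le> M" "\<bar>b'\<bar> \<le> M" "\<bar>a - a'\<bar> \<le> \<eta>" "\<bar>b - b'\<bar> \<le> \<eta>"
  shows "\<bar>a * b - a' * b'\<bar> \<le> 2 * M * \<eta>"
proof -
  have "a * b - a' * b' = a * (b - b') + b' * (a - a')" by (simp add: algebra_simps)
  then show ?thesis
    using abs_mult_le[OF assms(1,4)] abs_mult_le[OF assms(2,3)] by linarith
qed

section \<open>Size of the solutions\<close>

lemma toy_hydro_solutionD:
  assumes sol: "toy_hydro_solution N T \<theta> \<rho>"
  shows "zero_off_lattice N T \<rho>"
    and "j \<in> {1..int N} \<Longrightarrow> t \<in> {0..T} \<Longrightarrow> (\<theta> j has_real_derivative
           (- (\<rho> j t - \<rho> (j - 1) t)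
            - 2 * (\<rho> j t - \<rho> (j - 1) t) * cos (2 * \<theta> j t)
            + 2 * \<rho> (j + 1) t * cos (2 * \<theta> (j + 1) t)
            - 2 * \<rho> (j - 2) t * cos (2 * \<theta> (j - 1) t))) (at t within {0..T})"
    and "j \<in> {1..int N} \<Longrightarrow> t \<in> {0..T} \<Longrightarrow> (\<rho> j has_real_derivative
           (4 * \<rho> j t * \<rho> (j - 1) t * sin (2 * \<theta> j t)
            - 4 * \<rho> j t * \<rho> (j + 1) t * sin (2 * \<theta> (j + 1) t))) (at t within {0..T})"
proof -
  note * = sol[unfolded toy_hydro_solution_def, THEN conjunct2]
  show "zero_off_lattice N T \<rho>" by (rule *[THEN conjunct1])
  note ** = *[THEN conjunct2, THEN bspec, THEN bspec]
  show "(\<theta> j has_real_derivative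
           (- (\<rho> j t - \<rho> (j - 1) t)
            - 2 * (\<rho> j t - \<rho> (j - 1) t) * cos (2 * \<theta> j t)
            + 2 * \<rho> (j + 1) t * cos (2 * \<theta> (j + 1) t)
            - 2 * \<rho> (j - 2) t * cos (2 * \<theta> (j - 1) t))) (at t within {0..T})"
    if "j \<in> {1..int N}" "t \<in> {0..T}" by (rule **[OF that, THEN conjunct1])
  show "(\<rho> j has_real_derivative
           (4 * \<rho> j t * \<rho> (j - 1) t * sin (2 * \<theta> j t)
            - 4 * \<rho> j t * \<rho> (j + 1) t * sin (2 * \<theta> (j + 1) t))) (at t within {0..T})"
    if "j \<in> {1..int N}" "t \<in> {0..T}" by (rule **[OF that, THEN conjunct2])
qed

lemma reduced_hydro_solutionD:
  assumes sol: "reduced_hydro_solution N T \<theta> \<rho>"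
  shows "zero_off_lattice N T \<rho>"
    and "j \<in> {1..int N} \<Longrightarrow> t \<in> {0..T} \<Longrightarrow> (\<theta> j has_real_derivative (- (\<rho> j t - \<rho> (j - 1) t))) (at t within {0..T})"
    and "j \<in> {1..int N} \<Longrightarrow> t \<in> {0..T} \<Longrightarrow> (\<rho> j has_real_derivative (- 4 * \<rho> j t * (\<rho> (j + 1) t - \<rho> (j - 1) t)))
          (at t within {0..T})"
proof -
  note * = sol[unfolded reduced_hydro_solution_def, THEN conjunct2]
  show "zero_off_lattice N T \<rho>" by (rule *[THEN conjunct1])
  note ** = *[THEN conjunct2, THEN bspec, THEN bspec]
  show "(\<theta> j has_real_derivative (- (\<rho> j t - \<rho> (j - 1) t))) (at t within {0..T})"
    if "j \<in> {1..int N}" "t \<in> {0..T}" by (rule **[OF that, THEN conjunct1])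
  show "(\<rho> j has_real_derivative (- 4 * \<rho> j t * (\<rho> (j + 1) t - \<rho> (j - 1) t)))
          (at t within {0..T})"
    if "j \<in> {1..int N}" "t \<in> {0..T}" by (rule **[OF that, THEN conjunct2])
qed

text \<open>
  Both density equations have this form, with \<open>u j t = sin (2 * \<theta> j t)\<close> for the toy model and
  \<open>u j t = 1\<close> for the reduced one; only \<open>|u| \<le> 1\<close> matters for the size of the density.  The velocity
  is then at most \<open>8 (\<epsilon>/4)\<^sup>2 = \<epsilon>\<^sup>2/2\<close> while the densities are at most \<open>\<epsilon>/4\<close>.
\<close>

lemma transport_density_drift:
  fixes \<rho> :: "int \<Rightarrow> real \<Rightarrow> real"
  assumes \<epsilon>: "0 < \<epsilon>" and \<delta>: "\<delta> < 1/4" and T: "T = \<delta> / \<epsilon>"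
    and zero: "zero_off_lattice N T \<rho>"
    and deriv: "\<And>j t. j \<in> {1..int N} \<Longrightarrow> t \<in> {0..T} \<Longrightarrow>
      (\<rho> j has_real_derivative
         (4 * \<rho> j t * \<rho> (j - 1) t * u j t - 4 * \<rho> j t * \<rho> (j + 1) t * u (j + 1) t))
        (at t within {0..T})"
    and u: "\<And>j t. \<bar>u j t\<bar> \<le> 1"
    and init: "\<And>j. j \<in> {1..int N} \<Longrightarrow> \<rho> j 0 = \<epsilon> / 8"
    and t: "t \<in> {0..T}"
  shows "\<bar>\<rho> j t\<bar> \<le> \<epsilon> / 4" and "j \<in> {1..int N} \<Longrightarrow> \<bar>\<rho> j t - \<epsilon> / 8\<bar> \<le> \<delta> * \<epsilon> / 2"
proof -
  have BT: "\<epsilon>\<^sup>2 / 2 * T = \<delta> * \<epsilon> / 2" using \<epsilon> by (simp add: T power2_eq_square)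
  have \<delta>\<epsilon>: "\<delta> * \<epsilon> < 1/4 * \<epsilon>" using \<epsilon> \<delta> by (intro mult_strict_right_mono)
  have speed: "\<bar>4 * \<rho> j s * \<rho> (j - 1) s * u j s - 4 * \<rho> j s * \<rho> (j + 1) s * u (j + 1) s\<bar> \<le> \<epsilon>\<^sup>2 / 2"
    if "j \<in> {1..int N}" "s \<in> {0..T}" and small: "\<And>i. i \<in> {1..int N} \<Longrightarrow> \<bar>\<rho> i s\<bar> \<le> \<epsilon> / 4" for j s
  proof -
    have all: "\<bar>\<rho> i s\<bar> \<le> \<epsilon> / 4" for i
      using small[of i] zero that(2) \<epsilon> by (cases "i \<in> {1..int N}") (auto simp: zero_off_lattice_def)
    have "\<bar>\<rho> j s * \<rho> i s * u k s\<bar> \<le> (\<epsilon> / 4) * (\<epsilon> / 4) * 1" for i k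
      by (intro abs_mult_le all u)
    from this[of "j - 1" j] this[of "j + 1" "j + 1"] show ?thesis
      unfolding abs_le_iff by (auto simp: power2_eq_square algebra_simps)
  qed
  have room: "\<bar>\<epsilon> / 8\<bar> + \<epsilon>\<^sup>2 / 2 * T < \<epsilon> / 4" unfolding BT using \<delta>\<epsilon> \<epsilon> by linarith
  note * = bootstrap_bound[of "{1..int N}" T \<rho> _ "\<epsilon> / 8" "\<epsilon> / 4" "\<epsilon>\<^sup>2 / 2",
      OF _ deriv init speed _ room _ t, unfolded BT]
  show "\<bar>\<rho> j t\<bar> \<le> \<epsilon> / 4"
    using *(1)[of j] zero t \<epsilon> by (cases "j \<in> {1..int N}") (auto simp: zero_off_lattice_def)
  show "\<bar>\<rho> j t - \<epsilon> / 8\<bar> \<le> \<delta> * \<epsilon> / 2" if "j \<in> {1..int N}"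
    using *(2)[of j] that by auto
qed

lemma toy_density_drift:
  assumes "0 < \<epsilon>" "\<delta> < 1/4" "T = \<delta> / \<epsilon>" "toy_hydro_solution N T \<theta> \<rho>"
    and "\<And>j. j \<in> {1..int N} \<Longrightarrow> \<rho> j 0 = \<epsilon> / 8" "t \<in> {0..T}"
  shows "\<bar>\<rho> j t\<bar> \<le> \<epsilon> / 4" and "j \<in> {1..int N} \<Longrightarrow> \<bar>\<rho> j t - \<epsilon> / 8\<bar> \<le> \<delta> * \<epsilon> / 2"
proof -
  note * = transport_density_drift[where u = "\<lambda>j t. sin (2 * \<theta> j t)", OF assms(1-3)
      toy_hydro_solutionD(1,3)[OF assms(4)] _ assms(5,6)]
  show "\<bar>\<rho> j t\<bar> \<le> \<epsilon> / 4" by (rule *(1)) auto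
  show "\<bar>\<rho> j t - \<epsilon> / 8\<bar> \<le> \<delta> * \<epsilon> / 2" if "j \<in> {1..int N}" by (rule *(2)) (use that in auto)
qed

lemma reduced_density_drift:
  assumes "0 < \<epsilon>" "\<delta> < 1/4" "T = \<delta> / \<epsilon>" "reduced_hydro_solution N T \<theta> \<rho>"
    and "\<And>j. j \<in> {1..int N} \<Longrightarrow> \<rho> j 0 = \<epsilon> / 8" "t \<in> {0..T}"
  shows "\<bar>\<rho> j t\<bar> \<le> \<epsilon> / 4" and "j \<in> {1..int N} \<Longrightarrow> \<bar>\<rho> j t - \<epsilon> / 8\<bar> \<le> \<delta> * \<epsilon> / 2"
proof -
  have d: "(\<rho> j has_real_derivative
      (4 * \<rho> j t * \<rho> (j - 1) t * 1 - 4 * \<rho> j t * \<rho> (j + 1) t * 1)) (at t within {0..T})"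
    if "j \<in> {1..int N}" "t \<in> {0..T}" for j t
    by (rule DERIV_cong[OF reduced_hydro_solutionD(3)[OF assms(4) that]]) (simp add: algebra_simps)
  note * = transport_density_drift[where u = "\<lambda>_ _. 1", OF assms(1-3)
      reduced_hydro_solutionD(1)[OF assms(4)] d _ assms(5,6)]
  show "\<bar>\<rho> j t\<bar> \<le> \<epsilon> / 4" by (rule *(1)) auto
  show "\<bar>\<rho> j t - \<epsilon> / 8\<bar> \<le> \<delta> * \<epsilon> / 2" if "j \<in> {1..int N}" by (rule *(2)) (use that in auto)
qed

text \<open>
  The ten density terms of the phase equation, counted with multiplicity and each at most \<open>\<epsilon>/4\<close>,
  bound the velocity by \<open>5/2 * \<epsilon>\<close>.
\<close>

lemma toy_phase_drift:
  assumes \<epsilon>: "0 < \<epsilon>" and T: "T = \<delta> / \<epsilon>" and sol: "toy_hydro_solution N T \<theta> \<rho>"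
    and \<rho>: "\<And>j t. t \<in> {0..T} \<Longrightarrow> \<bar>\<rho> j t\<bar> \<le> \<epsilon> / 4"
    and j: "j \<in> {1..int N}" and init: "\<theta> j 0 = pi / 4" and t: "t \<in> {0..T}"
  shows "\<bar>\<theta> j t - pi / 4\<bar> \<le> 5 / 2 * \<delta>"
proof -
  have "\<bar>\<theta> j t - \<theta> j 0\<bar> \<le> 5 / 2 * \<epsilon> * t"
  proof (rule mean_value_bound[OF toy_hydro_solutionD(2)[OF sol j]])
    fix s assume "0 < s" "s < t"
    then have s: "s \<in> {0..T}" using t by auto
    have "\<bar>\<rho> i s * cos (2 * \<theta> k s)\<bar> \<le> \<epsilon> / 4 * 1" for i k
      by (intro abs_mult_le \<rho>[OF s]) simp
    from this[of j j] this[of "j - 1" j] this[of "j + 1" "j + 1"] this[of "j - 2" "j - 1"]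
      \<rho>[OF s, of j] \<rho>[OF s, of "j - 1"]
    show "\<bar>- (\<rho> j s - \<rho> (j - 1) s)
            - 2 * (\<rho> j s - \<rho> (j - 1) s) * cos (2 * \<theta> j s)
            + 2 * \<rho> (j + 1) s * cos (2 * \<theta> (j + 1) s)
            - 2 * \<rho> (j - 2) s * cos (2 * \<theta> (j - 1) s)\<bar> \<le> 5 / 2 * \<epsilon>"
      unfolding abs_le_iff by (auto simp: algebra_simps)
  qed (use t in auto)
  also have "\<dots> \<le> 5 / 2 * \<epsilon> * T" using t \<epsilon> by (intro mult_left_mono) auto
  also have "\<dots> = 5 / 2 * \<delta>" using \<epsilon> by (simp add: T)
  finally show ?thesis by (simp add: init)
qed

section \<open>Comparison of the two systems\<close>

text \<open>
  In each product \<open>\<rho>\<^sub>j * \<rho>\<^sub>k * sin (2 * \<theta>)\<close> the deviation of the sine from 1 costs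
  \<open>(\<epsilon>/4)\<^sup>2 * (5 * \<delta>)\<close>, and replacing the densities costs \<open>2 * (\<epsilon>/4) * (\<delta> * \<epsilon>)\<close>, the two densities
  being within \<open>\<delta> * \<epsilon> / 2\<close> of their common initial value; together \<open>13/16 * \<delta> * \<epsilon>\<^sup>2\<close>.  There are eight
  such products with multiplicity, so the two density velocities differ by at most
  \<open>13/2 * \<delta> * \<epsilon>\<^sup>2\<close>, which integrates to \<open>13/2 * \<delta>\<^sup>2 * \<epsilon>\<close>;
  this is at most \<open>\<delta> * \<epsilon> / 32\<close> exactly when \<open>\<delta> \<le> 1/208\<close>.  The phase velocities differ by two density
  differences and by the eight cosine terms, each at most \<open>\<epsilon>/4 * (5 * \<delta>)\<close>.
\<close>

lemma hydro_comparison: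
  assumes \<epsilon>: "0 < \<epsilon>" and \<delta>: "0 < \<delta>" "\<delta> \<le> 1/208" and T: "T = \<delta> / \<epsilon>"
    and toy: "toy_hydro_solution N T \<theta> \<rho>" and red: "reduced_hydro_solution N T \<theta>' \<rho>'"
    and init: "\<And>j. j \<in> {1..int N} \<Longrightarrow> \<theta> j 0 = pi / 4" "\<And>j. j \<in> {1..int N} \<Longrightarrow> \<theta>' j 0 = pi / 4"
      "\<And>j. j \<in> {1..int N} \<Longrightarrow> \<rho> j 0 = \<epsilon> / 8" "\<And>j. j \<in> {1..int N} \<Longrightarrow> \<rho>' j 0 = \<epsilon> / 8"
    and j: "j \<in> {1..int N}" and t: "t \<in> {0..T}"
  shows "\<bar>\<rho> j t - \<rho>' j t\<bar> \<le> \<delta> * \<epsilon> / 32" and "\<bar>\<theta> j t - \<theta>' j t\<bar> \<le> \<delta> / 8"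
proof -
  have \<delta>4: "\<delta> < 1/4" using \<delta> by simp
  have z: "\<rho> i s = 0" "\<rho>' i s = 0" if "s \<in> {0..T}" "i \<notin> {1..int N}" for i s
    using toy_hydro_solutionD(1)[OF toy] reduced_hydro_solutionD(1)[OF red] that
    by (simp_all add: zero_off_lattice_def)
  have \<rho>: "\<bar>\<rho> i s\<bar> \<le> \<epsilon> / 4" "i \<in> {1..int N} \<Longrightarrow> \<bar>\<rho> i s - \<epsilon> / 8\<bar> \<le> \<delta> * \<epsilon> / 2"
    if "s \<in> {0..T}" for i s
    using toy_density_drift[OF \<epsilon> \<delta>4 T toy _ that] init(3) by simp_all
  have \<rho>': "\<bar>\<rho>' i s\<bar> \<le> \<epsilon> / 4" "i \<in> {1..int N} \<Longrightarrow> \<bar>\<rho>' i s - \<epsilon> / 8\<bar> \<le> \<delta> * \<epsilon> / 2"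
    if "s \<in> {0..T}" for i s
    using reduced_density_drift[OF \<epsilon> \<delta>4 T red _ that] init(4) by simp_all
  have \<theta>: "\<bar>\<theta> i s - pi / 4\<bar> \<le> 5 / 2 * \<delta>" if "i \<in> {1..int N}" "s \<in> {0..T}" for i s
    using toy_phase_drift[OF \<epsilon> T toy \<rho>(1) that(1) init(1)[OF that(1)] that(2)] by simp
  have near: "\<bar>\<rho> i s - \<rho>' i s\<bar> \<le> \<delta> * \<epsilon>" if "s \<in> {0..T}" for i s
  proof (cases "i \<in> {1..int N}")
    case True
    from \<rho>(2)[OF that True] \<rho>'(2)[OF that True] show ?thesis by linarith
  next
    case False
    with z[OF that] \<delta> \<epsilon> show ?thesis by simp
  qed
  have trig: "\<bar>cos (2 * \<theta> i s)\<bar> \<le> 5 * \<delta>" "\<bar>sin (2 * \<theta> i s) - 1\<bar> \<le> 5 * \<delta>"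
    if "i \<in> {1..int N}" "s \<in> {0..T}" for i s
  proof -
    have "2 * \<bar>\<theta> i s - pi / 4\<bar> \<le> 5 * \<delta>" using mult_left_mono[OF \<theta>[OF that], of 2] by simp
    then show "\<bar>cos (2 * \<theta> i s)\<bar> \<le> 5 * \<delta>" "\<bar>sin (2 * \<theta> i s) - 1\<bar> \<le> 5 * \<delta>"
      using sin_cos_double_near_quarter_pi[of "\<theta> i s"] by (blast intro: order_trans)+
  qed
  \<comment> \<open>If the phase index \<open>l\<close> is off the lattice, \<open>\<theta> l\<close> is not near \<open>\<pi>/4\<close>, but then it only occurs
     next to a vanishing density.\<close>
  have speed_\<rho>: "\<bar>\<rho> i s * \<rho> k s * sin (2 * \<theta> l s) - \<rho>' i s * \<rho>' k s\<bar> \<le> 13 / 16 * \<delta> * \<epsilon>\<^sup>2"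
    if "l \<in> {1..int N} \<or> k \<notin> {1..int N}" and s: "s \<in> {0..T}" for i k l s
  proof (cases "l \<in> {1..int N}")
    case False
    with that have "k \<notin> {1..int N}" by blast
    from z[OF s this] \<delta> show ?thesis by simp
  next
    case True
    have 1: "\<bar>\<rho> i s * \<rho> k s * (sin (2 * \<theta> l s) - 1)\<bar> \<le> \<epsilon> / 4 * (\<epsilon> / 4) * (5 * \<delta>)"
      by (intro abs_mult_le \<rho>(1)[OF s] trig(2)[OF True s])
    have 2: "\<bar>\<rho> i s * \<rho> k s - \<rho>' i s * \<rho>' k s\<bar> \<le> 2 * (\<epsilon> / 4) * (\<delta> * \<epsilon>)"
      by (intro abs_mult_diff_le \<rho>(1)[OF s] \<rho>'(1)[OF s] near[OF s])
    from 1 2 show ?thesis unfolding abs_le_iff by (auto simp: power2_eq_square algebra_simps)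
  qed
  have diff_\<rho>: "\<bar>\<rho> i s - \<rho>' i s\<bar> \<le> 13 / 2 * \<delta>\<^sup>2 * \<epsilon>" if s: "s \<in> {0..T}" for i s
  proof (cases "i \<in> {1..int N}")
    case False
    from z[OF s this] \<epsilon> show ?thesis by simp
  next
    case True
    have "((\<lambda>s. \<rho> i s - \<rho>' i s) has_real_derivative
        (4 * \<rho> i s * \<rho> (i - 1) s * sin (2 * \<theta> i s)
            - 4 * \<rho> i s * \<rho> (i + 1) s * sin (2 * \<theta> (i + 1) s))
        - (- 4 * \<rho>' i s * (\<rho>' (i + 1) s - \<rho>' (i - 1) s))) (at s within {0..T})"
      if "s \<in> {0..T}" for s
      by (rule DERIV_diff[OF toy_hydro_solutionD(3)[OF toy True that]
            reduced_hydro_solutionD(3)[OF red True that]])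
    note d = mean_value_bound[OF this]
    have "\<bar>(\<rho> i s - \<rho>' i s) - (\<rho> i 0 - \<rho>' i 0)\<bar> \<le> 13 / 2 * \<delta> * \<epsilon>\<^sup>2 * s"
    proof (rule d)
      fix r assume "0 < r" "r < s"
      then have r: "r \<in> {0..T}" using s by auto
      have "\<bar>\<rho> i r * \<rho> (i - 1) r * sin (2 * \<theta> i r) - \<rho>' i r * \<rho>' (i - 1) r\<bar> \<le> 13 / 16 * \<delta> * \<epsilon>\<^sup>2"
        "\<bar>\<rho> i r * \<rho> (i + 1) r * sin (2 * \<theta> (i + 1) r) - \<rho>' i r * \<rho>' (i + 1) r\<bar> \<le> 13 / 16 * \<delta> * \<epsilon>\<^sup>2"
        using True by - (rule speed_\<rho>[OF _ r]; auto)+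
      then show "\<bar>(4 * \<rho> i r * \<rho> (i - 1) r * sin (2 * \<theta> i r)
            - 4 * \<rho> i r * \<rho> (i + 1) r * sin (2 * \<theta> (i + 1) r))
        - (- 4 * \<rho>' i r * (\<rho>' (i + 1) r - \<rho>' (i - 1) r))\<bar> \<le> 13 / 2 * \<delta> * \<epsilon>\<^sup>2"
        unfolding abs_le_iff by (auto simp: algebra_simps)
    qed (use s in auto)
    also have "\<dots> \<le> 13 / 2 * \<delta> * \<epsilon>\<^sup>2 * T" using s \<delta> by (intro mult_left_mono) auto
    also have "\<dots> = 13 / 2 * \<delta>\<^sup>2 * \<epsilon>" using \<epsilon> by (simp add: T power2_eq_square)
    finally show ?thesis using init(3,4)[OF True] by simp
  qed
  have sq: "\<delta>\<^sup>2 \<le> \<delta> / 208" using \<delta> by (simp add: power2_eq_square)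
  have small: "13 / 2 * \<delta>\<^sup>2 * \<epsilon> \<le> \<delta> * \<epsilon> / 32"
    using mult_right_mono[OF sq, of \<epsilon>] \<epsilon> by simp
  have close_\<rho>: "\<bar>\<rho> i s - \<rho>' i s\<bar> \<le> \<delta> * \<epsilon> / 32" if "s \<in> {0..T}" for i s
    by (rule order_trans[OF diff_\<rho>[OF that] small])
  show "\<bar>\<rho> j t - \<rho>' j t\<bar> \<le> \<delta> * \<epsilon> / 32" by (rule close_\<rho>[OF t])
  have speed_\<theta>: "\<bar>\<rho> k s * cos (2 * \<theta> l s)\<bar> \<le> \<epsilon> / 4 * (5 * \<delta>)"
    if "l \<in> {1..int N} \<or> k \<notin> {1..int N}" and s: "s \<in> {0..T}" for k l s
  proof (cases "l \<in> {1..int N}")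
    case False
    with that have "k \<notin> {1..int N}" by blast
    from z(1)[OF s this] \<delta> \<epsilon> show ?thesis by simp
  next
    case True
    then show ?thesis by (intro abs_mult_le \<rho>(1)[OF s] trig(1)[OF _ s])
  qed
  have "((\<lambda>s. \<theta> j s - \<theta>' j s) has_real_derivative
      (- (\<rho> j s - \<rho> (j - 1) s)
            - 2 * (\<rho> j s - \<rho> (j - 1) s) * cos (2 * \<theta> j s)
            + 2 * \<rho> (j + 1) s * cos (2 * \<theta> (j + 1) s)
            - 2 * \<rho> (j - 2) s * cos (2 * \<theta> (j - 1) s))
      - (- (\<rho>' j s - \<rho>' (j - 1) s))) (at s within {0..T})"
    if "s \<in> {0..T}" for s
    by (rule DERIV_diff[OF toy_hydro_solutionD(2)[OF toy j that]
          reduced_hydro_solutionD(2)[OF red j that]])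
  note d = mean_value_bound[OF this]
  have "\<bar>(\<theta> j t - \<theta>' j t) - (\<theta> j 0 - \<theta>' j 0)\<bar> \<le> (\<delta> * \<epsilon> / 16 + 10 * \<delta> * \<epsilon>) * t"
  proof (rule d)
    fix r assume "0 < r" "r < t"
    then have r: "r \<in> {0..T}" using t by auto
    have "\<bar>\<rho> j r * cos (2 * \<theta> j r)\<bar> \<le> \<epsilon> / 4 * (5 * \<delta>)"
      "\<bar>\<rho> (j - 1) r * cos (2 * \<theta> j r)\<bar> \<le> \<epsilon> / 4 * (5 * \<delta>)"
      "\<bar>\<rho> (j + 1) r * cos (2 * \<theta> (j + 1) r)\<bar> \<le> \<epsilon> / 4 * (5 * \<delta>)"
      "\<bar>\<rho> (j - 2) r * cos (2 * \<theta> (j - 1) r)\<bar> \<le> \<epsilon> / 4 * (5 * \<delta>)"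
      using j by - (rule speed_\<theta>[OF _ r]; auto)+
    with close_\<rho>[OF r, of j] close_\<rho>[OF r, of "j - 1"]
    show "\<bar>(- (\<rho> j r - \<rho> (j - 1) r)
            - 2 * (\<rho> j r - \<rho> (j - 1) r) * cos (2 * \<theta> j r)
            + 2 * \<rho> (j + 1) r * cos (2 * \<theta> (j + 1) r)
            - 2 * \<rho> (j - 2) r * cos (2 * \<theta> (j - 1) r))
      - (- (\<rho>' j r - \<rho>' (j - 1) r))\<bar> \<le> \<delta> * \<epsilon> / 16 + 10 * \<delta> * \<epsilon>"
      unfolding abs_le_iff by (auto simp: algebra_simps)
  qed (use t in auto)
  also have "\<dots> \<le> (\<delta> * \<epsilon> / 16 + 10 * \<delta> * \<epsilon>) * T" using t \<delta> \<epsilon> by (intro mult_left_mono) auto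
  also have "\<dots> = (1 / 16 + 10) * \<delta>\<^sup>2" using \<epsilon> by (simp add: T power2_eq_square field_simps)
  also have "\<dots> \<le> \<delta> / 8" using sq \<delta> by simp
  finally show "\<bar>\<theta> j t - \<theta>' j t\<bar> \<le> \<delta> / 8" using init(1,2)[OF j] by simp
qed

theorem theorem5p1:
  "\<exists>\<delta> \<epsilon>\<^sub>0 :: real. 0 < \<delta> \<and> \<delta> < 1/16 \<and> 0 < \<epsilon>\<^sub>0 \<and>
     (\<forall>(\<epsilon>::real) (N::nat). 0 < \<epsilon> \<and> \<epsilon> < \<epsilon>\<^sub>0 \<and> 1 \<le> N \<longrightarrow>
       (let T = \<delta> * inverse \<epsilon> in
        \<forall>(\<theta> :: int \<Rightarrow> real \<Rightarrow> real) (\<rho> :: int \<Rightarrow> real \<Rightarrow> real)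
          (\<theta>' :: int \<Rightarrow> real \<Rightarrow> real) (\<rho>' :: int \<Rightarrow> real \<Rightarrow> real).
          toy_hydro_solution N T \<theta> \<rho> \<and> reduced_hydro_solution N T \<theta>' \<rho>' \<and>
          (\<forall>j\<in>{1..int N}. \<theta> j 0 = pi / 4 \<and> \<theta>' j 0 = pi / 4 \<and>
                           \<rho> j 0 = \<epsilon> / 8 \<and> \<rho>' j 0 = \<epsilon> / 8)
          \<longrightarrow>
          (SUP t\<in>{0..T}. MAX j\<in>{1..int N}. \<bar>\<theta> j t - \<theta>' j t\<bar>) \<le> \<delta> / 8 \<and>
          (SUP t\<in>{0..T}. MAX j\<in>{1..int N}. \<bar>\<rho> j t - \<rho>' j t\<bar>) \<le> \<delta> * \<epsilon> / 32))"
  \<comment> \<open>1/208 is the threshold of \<open>hydro_comparison\<close>, whose estimates are uniform in \<open>\<epsilon>\<close>.\<close>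
proof (rule exI[of _ "1/208"], rule exI[of _ 1], intro conjI allI impI)
  fix \<epsilon> :: real and N :: nat
  assume \<epsilon>N: "0 < \<epsilon> \<and> \<epsilon> < 1 \<and> 1 \<le> N"
  define T where "T = 1/208 * inverse \<epsilon>"
  have T: "T = (1/208) / \<epsilon>" "{0..T} \<noteq> {}" using \<epsilon>N by (auto simp: T_def field_simps)
  show "let T = 1/208 * inverse \<epsilon> in
        \<forall>(\<theta> :: int \<Rightarrow> real \<Rightarrow> real) (\<rho> :: int \<Rightarrow> real \<Rightarrow> real)
          (\<theta>' :: int \<Rightarrow> real \<Rightarrow> real) (\<rho>' :: int \<Rightarrow> real \<Rightarrow> real).
          toy_hydro_solution N T \<theta> \<rho> \<and> reduced_hydro_solution N T \<theta>' \<rho>' \<and>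
          (\<forall>j\<in>{1..int N}. \<theta> j 0 = pi / 4 \<and> \<theta>' j 0 = pi / 4 \<and>
                           \<rho> j 0 = \<epsilon> / 8 \<and> \<rho>' j 0 = \<epsilon> / 8)
          \<longrightarrow>
          (SUP t\<in>{0..T}. MAX j\<in>{1..int N}. \<bar>\<theta> j t - \<theta>' j t\<bar>) \<le> 1/208 / 8 \<and>
          (SUP t\<in>{0..T}. MAX j\<in>{1..int N}. \<bar>\<rho> j t - \<rho>' j t\<bar>) \<le> 1/208 * \<epsilon> / 32"
    unfolding Let_def T_def[symmetric]
  proof (intro allI impI)
    fix \<theta> \<rho> \<theta>' \<rho>' :: "int \<Rightarrow> real \<Rightarrow> real"
    assume sol: "toy_hydro_solution N T \<theta> \<rho> \<and> reduced_hydro_solution N T \<theta>' \<rho>' \<and>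
          (\<forall>j\<in>{1..int N}. \<theta> j 0 = pi / 4 \<and> \<theta>' j 0 = pi / 4 \<and>
                           \<rho> j 0 = \<epsilon> / 8 \<and> \<rho>' j 0 = \<epsilon> / 8)"
    have *: "\<bar>\<rho> j t - \<rho>' j t\<bar> \<le> 1/208 * \<epsilon> / 32" "\<bar>\<theta> j t - \<theta>' j t\<bar> \<le> 1/208 / 8"
      if "j \<in> {1..int N}" "t \<in> {0..T}" for j t
      using hydro_comparison[of \<epsilon> "1/208" T N \<theta> \<rho> \<theta>' \<rho>' j t] \<epsilon>N T sol that by simp_all
    show "(SUP t\<in>{0..T}. MAX j\<in>{1..int N}. \<bar>\<theta> j t - \<theta>' j t\<bar>) \<le> 1/208 / 8 \<and>
          (SUP t\<in>{0..T}. MAX j\<in>{1..int N}. \<bar>\<rho> j t - \<rho>' j t\<bar>) \<le> 1/208 * \<epsilon> / 32"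
      using \<epsilon>N T(2) * by (intro conjI cSUP_least Max.boundedI) (auto simp del: divide_divide_eq_left)
  qed
qed auto

end
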